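(* Let $R$ be a non-local finite commutative ring with unity such that $R \cong R_1 \times R_2 \times \cdots \times R_n$, where $n \geq 2$ and each $R_i$ is a local ring with maximal ideal $\mathcal{M}_i$. Then the upper ideal relation graph $\Gamma_U(R)$ is a cograph if and only if $n=2$ (that is, $R \cong R_1 \times R_2$) and $\mathcal{M}_1$, $\mathcal{M}_2$ are principal ideals of $R_1$, $R_2$ respectively.
   Context: Rings have a unity. A ring is local if it has a unique maximal ideal. For $x\in R$, $(x)$ is the ideal generated by $x$. The upper ideal relation graph $\Gamma_U(R)$ is the simple undirected graph whose vertex set is the set of all non-unit elements of $R$ (including $0$), where two distinct vertices $x,y$ are adjacent if and only if there exists a non-unit $z\in R$ with $(x)\subseteq (z)$ and $(y)\subseteq (z)$. A cograph is a graph with no induced subgraph isomorphic to $P_4$ (the path on 4 vertices). The zero ideal is principal. *)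

theory Defs
  imports
    "HOL-Algebra.Algebra"
    "Graph_Theory.Pair_Digraph"
    "Graph_Theory.Digraph_Component"
    "Graph_Theory.Digraph_Isomorphism"
begin

text \<open>
  This is the usual notion for commutative rings. The zero ring has no maximal ideal,
  hence is not local.
\<close>

locale local_ring = ring +
  assumes unique_maximalideal: "\<exists>!M. maximalideal M R"

definition nonunits :: "('a, 'm) ring_scheme \<Rightarrow> 'a set" where
  "nonunits R = carrier R - Units R"

text \<open>
  As usual in \<open>Graph_Theory\<close>, a simple undirected graph is a symmetric loop-free digraph:
  every edge is represented by its two orientations.
\<close>

definition upper_ideal_graph :: "('a, 'm) ring_scheme \<Rightarrow> 'a pair_pre_digraph" where
  "upper_ideal_graph R = \<lparr>
     pverts = nonunits R,
     parcs = {(x, y). x \<in> nonunits R \<and> y \<in> nonunits R \<and> x \<noteq> y \<and>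
       (\<exists>z \<in> nonunits R. Idl\<^bsub>R\<^esub> {x} \<subseteq> Idl\<^bsub>R\<^esub> {z} \<and> Idl\<^bsub>R\<^esub> {y} \<subseteq> Idl\<^bsub>R\<^esub> {z})} \<rparr>"

definition path_graph :: "nat \<Rightarrow> nat pair_pre_digraph" where
  "path_graph n = \<lparr>
     pverts = {..<n},
     parcs = {(i, j). i < n \<and> j < n \<and> (j = Suc i \<or> i = Suc j)} \<rparr>"

definition cograph :: "('a, 'b) pre_digraph \<Rightarrow> bool" where
  "cograph G \<longleftrightarrow> graph G \<and>
     \<not> (\<exists>H. induced_subgraph H G \<and> digraph_iso H (with_proj (path_graph 4)))"

lemma graph_upper_ideal_graph:
  assumes "finite (carrier R)"
  shows "graph (with_proj (upper_ideal_graph R))"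
proof -
  have fin: "finite (nonunits R)"
    using assms by (simp add: nonunits_def)
  have "parcs (upper_ideal_graph R) \<subseteq> nonunits R \<times> nonunits R"
    by (auto simp: upper_ideal_graph_def)
  then have "finite (parcs (upper_ideal_graph R))"
    using fin by (meson finite_SigmaI finite_subset)
  moreover have "symmetric (with_proj (upper_ideal_graph R))"
    by (auto simp: symmetric_def sym_def upper_ideal_graph_def arcs_ends_conv)
  ultimately interpret pair_graph "upper_ideal_graph R"
    using fin by unfold_locales (auto simp: upper_ideal_graph_def)
  show ?thesis
    by unfold_locales
qed

lemma graph_path_graph: "graph (with_proj (path_graph n))"
proof -
  have "parcs (path_graph n) \<subseteq> {..<n} \<times> {..<n}"
    by (auto simp: path_graph_def)
  then have "finite (parcs (path_graph n))"
    by (meson finite_SigmaI finite_lessThan finite_subset)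
  moreover have "symmetric (with_proj (path_graph n))"
    by (auto simp: symmetric_def sym_def path_graph_def arcs_ends_conv)
  ultimately interpret pair_graph "path_graph n"
    by unfold_locales (auto simp: path_graph_def)
  show ?thesis
    by unfold_locales
qed

end

theory Submission
  imports Defs
begin

text \<open>
  Two vertices are adjacent iff they have a common non-unit divisor, and divisibility in a product
  is componentwise. If both maximal ideals of \<open>R\<^sub>1 \<times> R\<^sub>2\<close> are principal, the graph is the union
  of the two cliques \<open>\<M>\<^sub>1 \<times> R\<^sub>2\<close> and \<open>R\<^sub>1 \<times> \<M>\<^sub>2\<close>, which contains no induced path on four
  vertices. If \<open>\<M>\<^sub>1\<close> is not principal, it contains \<open>a\<close>, \<open>b\<close> without a common non-unit divisor, and
  \<open>(a, 1), (a, 0), (b, 0), (b, 1)\<close> is an induced path. With three factors,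
  \<open>(0, 1, 1), (0, 0, 1), (1, 0, 0), (1, 1, 0)\<close> is one.
\<close>

section \<open>Induced paths on four vertices\<close>

text \<open>Symmetry settles the opposite orientations and, together with the absence of loops,
  forces the four vertices to be distinct. So the six conditions describe exactly an induced
  path.\<close>

lemma cograph_with_proj_iff:
  assumes "graph (with_proj G)"
  shows "cograph (with_proj G) \<longleftrightarrow>
    \<not> (\<exists>a b c d. (a, b) \<in> parcs G \<and> (b, c) \<in> parcs G \<and> (c, d) \<in> parcs G \<and>
      (a, c) \<notin> parcs G \<and> (a, d) \<notin> parcs G \<and> (b, d) \<notin> parcs G)"
proof -
  interpret pair_graph G
    using assms by (rule pair_graphI_graph)
  have sym: "(x, y) \<in> parcs G \<longleftrightarrow> (y, x) \<in> parcs G" for x y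
    using arcs_symmetric by blast
  have loopfree: "(x, x) \<notin> parcs G" for x
    using no_loops by fastforce
  have "(\<exists>H. induced_subgraph H (with_proj G) \<and> digraph_iso H (with_proj (path_graph 4))) \<longleftrightarrow>
    (\<exists>a b c d. (a, b) \<in> parcs G \<and> (b, c) \<in> parcs G \<and> (c, d) \<in> parcs G \<and>
      (a, c) \<notin> parcs G \<and> (a, d) \<notin> parcs G \<and> (b, d) \<notin> parcs G)" (is "?L \<longleftrightarrow> ?R")
  proof
    assume ?L
    then obtain H f where H: "induced_subgraph H (with_proj G)"
      and f: "pre_digraph.digraph_isomorphism H f" and eq: "with_proj (path_graph 4) = app_iso f H"
      unfolding digraph_iso_def by blast
    have H_arcs: "arcs H = {e \<in> parcs G. fst e \<in> verts H \<and> snd e \<in> verts H}"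
      using H by (simp add: induced_subgraph_def)
    have H_proj: "tail H = fst" "head H = snd"
      using H by (auto simp: induced_subgraph_def subgraph_def compatible_def)
    have verts: "iso_verts f ` verts H = {..<4}" and arcs: "iso_arcs f ` arcs H = parcs (path_graph 4)"
      and tail: "iso_tail f = fst" and head: "iso_head f = snd"
      using arg_cong[OF eq, of verts] arg_cong[OF eq, of arcs]
        arg_cong[OF eq, of tail] arg_cong[OF eq, of head] by (auto simp: path_graph_def)
    \<comment> \<open>\<open>g\<close> inverts the vertex map, so \<open>g 0\<close>,
      \<open>g 1\<close>, \<open>g 2\<close>, \<open>g 3\<close> run along the path in
      order.\<close>
    define g where "g = the_inv_into (verts H) (iso_verts f)"
    have inj: "inj_on (iso_verts f) (verts H)"
      using f by (simp add: pre_digraph.digraph_isomorphism_def)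
    have g: "g k \<in> verts H" "iso_verts f (g k) = k" if "k < 4" for k
      unfolding g_def using that verts inj
      by (auto intro!: the_inv_into_into f_the_inv_into_f)
    have g_iso: "g (iso_verts f v) = v" if "v \<in> verts H" for v
      unfolding g_def using that inj by (simp add: the_inv_into_f_f)
    \<comment> \<open>Arcs of both graphs are the pairs of their endpoints, so the vertex map
      determines the arc map.\<close>
    have ends: "iso_arcs f e = (iso_verts f (fst e), iso_verts f (snd e))" if "e \<in> arcs H" for e
      using f that by (auto simp: pre_digraph.digraph_isomorphism_def H_proj tail head prod_eq_iff)
    have "(g i, g j) \<in> parcs G \<longleftrightarrow> (i, j) \<in> parcs (path_graph 4)" if ij: "i < 4" "j < 4" for i j
    proof
      assume "(g i, g j) \<in> parcs G"
      then have "(g i, g j) \<in> arcs H"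
        using g ij by (simp add: H_arcs)
      then show "(i, j) \<in> parcs (path_graph 4)"
        using ends arcs g ij by force
    next
      assume "(i, j) \<in> parcs (path_graph 4)"
      then obtain e where e: "e \<in> arcs H" "iso_arcs f e = (i, j)"
        using arcs by force
      then have "iso_verts f (fst e) = i" "iso_verts f (snd e) = j"
        using ends by auto
      then have "e = (g i, g j)"
        using e(1) g_iso[of "fst e"] g_iso[of "snd e"] by (auto simp: H_arcs prod_eq_iff)
      then show "(g i, g j) \<in> parcs G"
        using e by (simp add: H_arcs)
    qed
    then show ?R
      by (intro exI[of _ "g 0"] exI[of _ "g 1"] exI[of _ "g 2"] exI[of _ "g 3"])
        (simp add: path_graph_def)
  next
    assume ?R
    then obtain a b c d where path: "(a, b) \<in> parcs G" "(b, c) \<in> parcs G" "(c, d) \<in> parcs G"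
      "(a, c) \<notin> parcs G" "(a, d) \<notin> parcs G" "(b, d) \<notin> parcs G"
      by blast
    then have path_rev: "(b, a) \<in> parcs G" "(c, b) \<in> parcs G" "(d, c) \<in> parcs G"
      "(c, a) \<notin> parcs G" "(d, a) \<notin> parcs G" "(d, b) \<notin> parcs G"
      using sym by blast+
    have distinct: "a \<noteq> b" "a \<noteq> c" "a \<noteq> d" "b \<noteq> c" "b \<noteq> d" "c \<noteq> d"
      using path path_rev loopfree by blast+
    define V where "V = {a, b, c, d}"
    define E where "E = {(a, b), (b, a), (b, c), (c, b), (c, d), (d, c)}"
    define H where "H = with_proj \<lparr>pverts = V, parcs = E\<rparr>"
    \<comment> \<open>The numbering follows the path; on \<open>V\<close> the last branch is reached
      only at \<open>d\<close>.\<close>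
    define n where "n x = (if x = a then 0 else if x = b then 1 else if x = c then 2 else 3 :: nat)" for x
    define f where "f = \<lparr>iso_verts = n, iso_arcs = map_prod n n, iso_head = snd, iso_tail = fst\<rparr>"
    have n: "n a = 0" "n b = 1" "n c = 2" "n d = 3"
      using distinct by (auto simp: n_def)
    have H_sel: "verts H = V" "arcs H = E" "tail H = fst" "head H = snd"
      by (auto simp: H_def)
    have "(x, y) \<in> parcs G \<longleftrightarrow> (x, y) \<in> E" if "x \<in> V" "y \<in> V" for x y
      using that unfolding V_def E_def by (elim insertE emptyE)
        (simp_all add: path path_rev loopfree distinct distinct[symmetric])
    moreover have E_ends: "e \<in> E \<Longrightarrow> fst e \<in> V \<and> snd e \<in> V" for e
      by (auto simp: E_def V_def)
    \<comment> \<open>This is what makes \<open>H\<close> induced: \<open>E\<close> misses no arc of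
      \<open>G\<close> between vertices of \<open>V\<close>.\<close>
    ultimately have E_eq: "E = {e \<in> parcs G. fst e \<in> V \<and> snd e \<in> V}"
      by (metis (mono_tags, lifting) Collect_cong mem_Collect_eq prod.collapse Collect_mem_eq)
    have "V \<subseteq> pverts G"
      using path by (auto simp: V_def dest: in_arcsD1 in_arcsD2)
    moreover have "wf_digraph H"
      by unfold_locales (auto simp: H_sel E_ends)
    ultimately have "induced_subgraph H (with_proj G)"
      using wf_digraph_axioms
      by (auto simp: induced_subgraph_def subgraph_def compatible_def H_sel E_eq)
    moreover have "inj_on n V"
      using n by (auto simp: inj_on_def V_def)
    then have "pre_digraph.digraph_isomorphism H f"
      unfolding pre_digraph.digraph_isomorphism_def
      using \<open>wf_digraph H\<close> E_ends by (auto simp: f_def H_sel inj_on_def prod_eq_iff)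
    moreover have "with_proj (path_graph 4) = app_iso f H"
    proof -
      have "{(i, j). i < 4 \<and> j < 4 \<and> (j = Suc i \<or> i = Suc j)} =
        {(0, 1), (1, 0), (1, 2), (2, 1), (2, 3), (3, 2)}"
        by auto
      moreover have "{..<4 :: nat} = {0, 1, 2, 3}"
        by auto
      ultimately show ?thesis
        unfolding with_proj_def app_iso_def path_graph_def
        by (simp add: f_def H_sel E_def V_def n)
    qed
    ultimately show ?L
      unfolding digraph_iso_def by blast
  qed
  then show ?thesis
    using assms by (simp add: cograph_def)
qed

section \<open>Divisibility and maximal ideals in finite rings\<close>

text \<open>Replaces the ideals in the adjacency condition by a relation that can be checked factor
  by factor.\<close>

lemma (in cring) genideal_subset_iff_divides:
  assumes "x \<in> carrier R" "z \<in> carrier R"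
  shows "Idl {x} \<subseteq> Idl {z} \<longleftrightarrow> z divides x"
  using assms by (simp add: to_contain_is_to_divide flip: cgenideal_eq_genideal)

lemma (in cring) parcs_upper_ideal_graph_iff:
  "(x, y) \<in> parcs (upper_ideal_graph R) \<longleftrightarrow>
    x \<in> nonunits R \<and> y \<in> nonunits R \<and> x \<noteq> y \<and> (\<exists>z \<in> nonunits R. z divides x \<and> z divides y)"
  by (auto simp: upper_ideal_graph_def nonunits_def genideal_subset_iff_divides)

text \<open>Finiteness takes the place of Zorn's lemma: among the finitely many proper ideals above
  \<open>I\<close>, one that is maximal under inclusion is a maximal ideal.\<close>

lemma (in ring) exists_maximalideal_finite:
  assumes "finite (carrier R)" "ideal I R" "I \<noteq> carrier R"
  shows "\<exists>J. maximalideal J R \<and> I \<subseteq> J"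
proof -
  define \<I> where "\<I> = {J. ideal J R \<and> J \<noteq> carrier R \<and> I \<subseteq> J}"
  have sub: "J \<subseteq> carrier R" if "ideal J R" for J
    using that by (simp add: additive_subgroup.a_subset ideal.axioms(1))
  have "finite \<I>"
    using assms(1) sub by (intro finite_subset[of \<I> "Pow (carrier R)"]) (auto simp: \<I>_def)
  moreover have "I \<in> \<I>"
    using assms by (simp add: \<I>_def)
  ultimately obtain J where J: "J \<in> \<I>" "\<forall>K\<in>\<I>. J \<subseteq> K \<longrightarrow> J = K"
    using finite_has_maximal2[of \<I> I] by blast
  have "maximalideal J R"
  proof (rule maximalidealI)
    show "K = J \<or> K = carrier R" if "ideal K R" "J \<subseteq> K" "K \<subseteq> carrier R" for K
      using J that by (auto simp: \<I>_def)
  qed (use J in \<open>auto simp: \<I>_def\<close>)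
  with J(1) show ?thesis
    by (auto simp: \<I>_def)
qed

text \<open>A unit in \<open>M\<close> would put \<open>\<one>\<close> into \<open>M\<close>. A
  non-unit generates a proper ideal, which lies in some maximal ideal, and by uniqueness that ideal
  is \<open>M\<close>.\<close>

lemma (in cring) local_ring_Units_iff:
  assumes "local_ring R" "finite (carrier R)" "maximalideal M R" "x \<in> carrier R"
  shows "x \<in> Units R \<longleftrightarrow> x \<notin> M"
proof -
  interpret M: maximalideal M R by fact
  have "\<one> \<notin> M"
    using M.I_notcarr M.one_imp_carrier by auto
  then have "x \<notin> M" if "x \<in> Units R"
    using that M.I_l_closed[of x "inv x"] Units_l_inv Units_inv_closed by auto
  moreover have "x \<in> M" if "x \<notin> Units R"
  proof -
    have "\<one> \<notin> PIdl x"
      using that assms(4) divides_one[OF assms(4)] m_comm by (auto simp: cgenideal_def factor_def)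
    then have "PIdl x \<noteq> carrier R"
      by auto
    then obtain J where J: "maximalideal J R" "PIdl x \<subseteq> J"
      using exists_maximalideal_finite assms(2,4) cgenideal_ideal by blast
    then have "J = M"
      using assms(1,3) local_ring.unique_maximalideal by blast
    with J show ?thesis
      using cgenideal_self assms(4) by blast
  qed
  ultimately show ?thesis
    by blast
qed

text \<open>The two elements generate a maximal principal ideal inside \<open>M\<close> and a principal ideal not
  contained in it.\<close>

lemma (in cring) ex_no_common_divisor_of_not_principal:
  assumes "finite (carrier R)" "ideal M R" "\<not> principalideal M R"
  shows "\<exists>a\<in>M. \<exists>b\<in>M. \<forall>z\<in>M. \<not> (z divides a \<and> z divides b)"
proof -
  interpret M: ideal M R by fact
  let ?P = "(\<lambda>x. PIdl x) ` M"
  have carr: "x \<in> carrier R" if "x \<in> M" for x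
    using that M.Icarr by blast
  have "finite ?P" "?P \<noteq> {}"
    using finite_subset[OF M.a_subset assms(1)] M.zero_closed by blast+
  then obtain P where P: "P \<in> ?P" "\<forall>Q\<in>?P. P \<subseteq> Q \<longrightarrow> P = Q"
    using finite_has_maximal[of ?P] by metis
  then obtain a where a: "a \<in> M" "\<And>z. z \<in> M \<Longrightarrow> PIdl a \<subseteq> PIdl z \<Longrightarrow> PIdl z = PIdl a"
    by auto
  have "PIdl a \<noteq> M"
    using assms(3) cgenideal_is_principalideal carr[OF a(1)] by auto
  then obtain b where b: "b \<in> M" "b \<notin> PIdl a"
    using cgenideal_minimal[OF assms(2) a(1)] by blast
  have "\<not> (z divides a \<and> z divides b)" if z: "z \<in> M" for z
  proof
    assume "z divides a \<and> z divides b"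
    \<comment> \<open>Maximality of \<open>PIdl a\<close> turns the first inclusion into an
      equality, and the second then puts \<open>b\<close> into \<open>PIdl a\<close>.\<close>
    then have "PIdl a \<subseteq> PIdl z" "PIdl b \<subseteq> PIdl z"
      using to_contain_is_to_divide carr a(1) b(1) z by auto
    with a(2)[OF z] b(2) show False
      using cgenideal_self[OF carr[OF b(1)]] by auto
  qed
  with a(1) b(1) show ?thesis
    by blast
qed

section \<open>Finite commutative rings as products of local rings\<close>

text \<open>The product is described by its projections \<open>p i\<close>, jointly injective and
  jointly surjective, so that the arguments do not depend on how tuples are represented.\<close>

locale local_ring_product = cring R for R :: "('a, 'm) ring_scheme" (structure) +
  fixes I :: "'i set" and S :: "'i \<Rightarrow> ('b, 'k) ring_scheme" and M :: "'i \<Rightarrow> 'b set"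
    and p :: "'i \<Rightarrow> 'a \<Rightarrow> 'b"
  assumes finite_carrier: "finite (carrier R)"
    and local_factor: "i \<in> I \<Longrightarrow> local_ring (S i)"
    and maximalideal_factor: "i \<in> I \<Longrightarrow> maximalideal (M i) (S i)"
    and proj_hom: "i \<in> I \<Longrightarrow> p i \<in> ring_hom R (S i)"
    and proj_inj: "x \<in> carrier R \<Longrightarrow> y \<in> carrier R \<Longrightarrow> (\<And>i. i \<in> I \<Longrightarrow> p i x = p i y) \<Longrightarrow> x = y"
    and proj_surj: "(\<And>i. i \<in> I \<Longrightarrow> c i \<in> carrier (S i)) \<Longrightarrow> \<exists>x\<in>carrier R. \<forall>i\<in>I. p i x = c i"
begin

lemma ring_factor: "i \<in> I \<Longrightarrow> ring (S i)"
  using local_factor local_ring.axioms(1) by blast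

lemma proj_closed: "i \<in> I \<Longrightarrow> x \<in> carrier R \<Longrightarrow> p i x \<in> carrier (S i)"
  using proj_hom ring_hom_closed by metis

lemma proj_onto:
  assumes "i \<in> I" "y \<in> carrier (S i)"
  shows "\<exists>x\<in>carrier R. p i x = y"
proof -
  have "(if k = i then y else \<zero>\<^bsub>S k\<^esub>) \<in> carrier (S k)" if "k \<in> I" for k
    using assms ring.ring_simprules(2)[OF ring_factor[OF that]] by auto
  then show ?thesis
    using proj_surj[of "\<lambda>k. if k = i then y else \<zero>\<^bsub>S k\<^esub>"] assms(1) by fastforce
qed

text \<open>Each factor is a homomorphic image of the commutative ring \<open>R\<close>;
  \<open>local_ring\<close> itself does not include commutativity.\<close>

lemma cring_factor: "i \<in> I \<Longrightarrow> cring (S i)"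
proof (intro cring.intro comm_monoid.intro comm_monoid_axioms.intro)
  assume i: "i \<in> I"
  show "ring (S i)" "monoid (S i)"
    using ring_factor[OF i] by (auto simp: ring_def)
  fix x y assume "x \<in> carrier (S i)" "y \<in> carrier (S i)"
  then show "x \<otimes>\<^bsub>S i\<^esub> y = y \<otimes>\<^bsub>S i\<^esub> x"
    using proj_onto[OF i] ring_hom_mult[OF proj_hom[OF i]] m_comm by metis
qed

lemma finite_factor: "i \<in> I \<Longrightarrow> finite (carrier (S i))"
  by (rule finite_surj[OF finite_carrier, of _ "p i"]) (use proj_onto in blast)

text \<open>Cofactors chosen in the single factors are glued by joint surjectivity, and joint
  injectivity shows that the glued element is a cofactor in \<open>R\<close>.\<close>

lemma divides_iff:
  assumes "x \<in> carrier R" "y \<in> carrier R"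
  shows "x divides y \<longleftrightarrow> (\<forall>i\<in>I. p i x divides\<^bsub>S i\<^esub> p i y)"
proof
  assume "x divides y"
  then show "\<forall>i\<in>I. p i x divides\<^bsub>S i\<^esub> p i y"
    using assms(1) proj_closed ring_hom_mult[OF proj_hom]
    by (auto simp: factor_def)
next
  assume "\<forall>i\<in>I. p i x divides\<^bsub>S i\<^esub> p i y"
  then obtain c where c: "\<And>i. i \<in> I \<Longrightarrow> c i \<in> carrier (S i) \<and> p i y = p i x \<otimes>\<^bsub>S i\<^esub> c i"
    unfolding factor_def by metis
  then obtain w where w: "w \<in> carrier R" "\<forall>i\<in>I. p i w = c i"
    using proj_surj by metis
  have "y = x \<otimes> w"
    using assms w c by (intro proj_inj) (auto simp: ring_hom_mult[OF proj_hom])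
  then show "x divides y"
    using w by (auto simp: factor_def)
qed

text \<open>Units are the divisors of one, so this is a case of componentwise divisibility.\<close>

lemma Units_iff:
  assumes "x \<in> carrier R"
  shows "x \<in> Units R \<longleftrightarrow> (\<forall>i\<in>I. p i x \<in> Units (S i))"
proof -
  have "x \<in> Units R \<longleftrightarrow> x divides \<one>"
    using assms divides_one by auto
  also have "\<dots> \<longleftrightarrow> (\<forall>i\<in>I. p i x divides\<^bsub>S i\<^esub> \<one>\<^bsub>S i\<^esub>)"
    using assms by (simp add: divides_iff ring_hom_one[OF proj_hom])
  also have "\<dots> \<longleftrightarrow> (\<forall>i\<in>I. p i x \<in> Units (S i))"
    using assms cring.divides_one[OF cring_factor] proj_closed by auto
  finally show ?thesis .
qed

lemma factor_Units_iff: "i \<in> I \<Longrightarrow> x \<in> carrier (S i) \<Longrightarrow> x \<in> Units (S i) \<longleftrightarrow> x \<notin> M i"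
  using cring.local_ring_Units_iff cring_factor local_factor finite_factor maximalideal_factor
  by metis

lemma nonunits_iff: "x \<in> nonunits R \<longleftrightarrow> x \<in> carrier R \<and> (\<exists>i\<in>I. p i x \<in> M i)"
  using Units_iff factor_Units_iff proj_closed by (auto simp: nonunits_def)

lemma ideal_factor: "i \<in> I \<Longrightarrow> ideal (M i) (S i)"
  using maximalideal_factor maximalideal.axioms(1) by blast

lemma zero_in_max: "i \<in> I \<Longrightarrow> \<zero>\<^bsub>S i\<^esub> \<in> M i"
  using ideal_factor additive_subgroup.zero_closed ideal.axioms(1) by blast

lemma one_notin_max: "i \<in> I \<Longrightarrow> \<one>\<^bsub>S i\<^esub> \<notin> M i"
  using factor_Units_iff[of i "\<one>\<^bsub>S i\<^esub>"] monoid.Units_one_closed monoid.one_closed ring_factor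
    ring.is_monoid by metis

lemma max_closed: "i \<in> I \<Longrightarrow> x \<in> M i \<Longrightarrow> x \<in> carrier (S i)"
  using ideal_factor ideal.Icarr by metis

lemma max_if_divides:
  assumes "i \<in> I" "x \<in> M i" "x divides\<^bsub>S i\<^esub> y"
  shows "y \<in> M i"
  using assms(2,3) ideal.I_r_closed[OF ideal_factor[OF assms(1)]] by (auto simp: factor_def)

lemma max_divisor:
  assumes "i \<in> I" "z divides x" "z \<in> carrier R" "x \<in> carrier R" "p i x \<notin> M i"
  shows "p i z \<notin> M i"
  using assms max_if_divides[OF assms(1)] divides_iff[OF assms(3,4)] by blast

lemma graph: "graph (with_proj (upper_ideal_graph R))"
  using finite_carrier by (rule graph_upper_ideal_graph)

text \<open>The common non-unit divisor is \<open>x\<close> itself; as a multiple of a non-unit,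
  \<open>y\<close> is a vertex too.\<close>

lemma adjacent_if_divides:
  assumes "x \<in> nonunits R" "y \<in> carrier R" "x divides y" "x \<noteq> y"
  shows "(x, y) \<in> parcs (upper_ideal_graph R)" "(y, x) \<in> parcs (upper_ideal_graph R)"
proof -
  obtain i where i: "i \<in> I" "p i x \<in> M i" and x: "x \<in> carrier R"
    using assms(1) by (auto simp: nonunits_iff)
  then have "p i y \<in> M i"
    using assms(2,3) max_divisor by blast
  then have "y \<in> nonunits R"
    using assms(2) i by (auto simp: nonunits_iff)
  then show "(x, y) \<in> parcs (upper_ideal_graph R)" "(y, x) \<in> parcs (upper_ideal_graph R)"
    using assms x unfolding parcs_upper_ideal_graph_iff by auto
qed

text \<open>An element of \<open>R\<close> with no component in a maximal ideal is a unit, so every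
  common divisor is a unit here.\<close>

lemma not_adjacent_if_no_common_max:
  assumes "\<And>i z. i \<in> I \<Longrightarrow> z \<in> carrier R \<Longrightarrow> z divides x \<Longrightarrow> z divides y \<Longrightarrow> p i z \<notin> M i"
  shows "(x, y) \<notin> parcs (upper_ideal_graph R)"
  using assms by (auto simp: parcs_upper_ideal_graph_iff nonunits_iff)

section \<open>Induced paths from three factors or a non-principal maximal ideal\<close>

text \<open>With \<open>v A\<close> zero on \<open>A\<close> and one elsewhere, the path is
  \<open>v {i}\<close>, \<open>v {i, j}\<close>, \<open>v {j, k}\<close>, \<open>v {k}\<close>: two
  of these are adjacent exactly when their index sets meet.\<close>

lemma not_cograph_if_three_factors:
  assumes ijk: "i \<in> I" "j \<in> I" "k \<in> I" "i \<noteq> j" "i \<noteq> k" "j \<noteq> k"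
  shows "\<not> cograph (with_proj (upper_ideal_graph R))"
proof -
  define c where "c A l = (if l \<in> A then \<zero>\<^bsub>S l\<^esub> else \<one>\<^bsub>S l\<^esub>)" for A l
  have "c A l \<in> carrier (S l)" if "l \<in> I" for A l
    using ring_factor[OF that] by (simp add: c_def ring.ring_simprules)
  then have "\<exists>v. \<forall>A. v A \<in> carrier R \<and> (\<forall>l\<in>I. p l (v A) = c A l)"
    using proj_surj[of "c _"] by metis
  then obtain v where v: "\<And>A. v A \<in> carrier R" "\<And>A l. l \<in> I \<Longrightarrow> p l (v A) = c A l"
    by blast
  have vM: "p l (v A) \<in> M l \<longleftrightarrow> l \<in> A" if "l \<in> I" for l A
    using that zero_in_max one_notin_max by (simp add: v c_def)
  have v_nonunit: "v A \<in> nonunits R" if "A \<inter> I \<noteq> {}" for A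
    using that v(1) vM by (auto simp: nonunits_iff)
  have v_div: "v A divides v B" if "A \<subseteq> B" for A B
    using that ring_factor ring.one_divides ring.divides_zero v
    by (auto simp: divides_iff c_def ring.ring_simprules intro!: ring.divides_zero ring.one_divides)
  have v_neq: "v A \<noteq> v B" if "l \<in> I" "l \<in> A \<longleftrightarrow> l \<notin> B" for l A B
    using vM that by metis
  \<comment> \<open>At every index one of the two elements has component one, which keeps the
    component of a common divisor out of the maximal ideal.\<close>
  have disj: "(v A, v B) \<notin> parcs (upper_ideal_graph R)" if "A \<inter> B = {}" for A B
    using that v(1) vM max_divisor by (intro not_adjacent_if_no_common_max) blast
  have "(v {i}, v {i, j}) \<in> parcs (upper_ideal_graph R)"
    "(v {j, k}, v {k}) \<in> parcs (upper_ideal_graph R)"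
    using ijk v_neq[OF ijk(2), of "{i}" "{i, j}"] v_neq[OF ijk(2), of "{k}" "{j, k}"]
    by (auto intro!: adjacent_if_divides(1)[of "v {i}"] adjacent_if_divides(2)[of "v {k}"]
        v v_nonunit v_div)
  \<comment> \<open>Neither vertex of the middle edge divides the other; the common divisor is
    \<open>v {j}\<close>.\<close>
  moreover have "(v {i, j}, v {j, k}) \<in> parcs (upper_ideal_graph R)"
    unfolding parcs_upper_ideal_graph_iff
    using ijk v_div[of "{j}" "{i, j}"] v_div[of "{j}" "{j, k}"]
      v_neq[OF ijk(1), of "{i, j}" "{j, k}"]
    by (auto intro!: v_nonunit bexI[of _ "v {j}"])
  moreover have "(v {i}, v {j, k}) \<notin> parcs (upper_ideal_graph R)"
    "(v {i}, v {k}) \<notin> parcs (upper_ideal_graph R)"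
    "(v {i, j}, v {k}) \<notin> parcs (upper_ideal_graph R)"
    using ijk by (auto intro!: disj)
  ultimately show ?thesis
    unfolding cograph_with_proj_iff[OF graph] by blast
qed

text \<open>The path is \<open>v a False\<close>, \<open>v a True\<close>, \<open>v b True\<close>,
  \<open>v b False\<close>. The first argument of \<open>v\<close> is the component at
  \<open>i\<close>; the flag decides between zero and one at \<open>j\<close>.\<close>

lemma not_cograph_if_not_principal:
  assumes ij: "i \<in> I" "j \<in> I" "i \<noteq> j" and np: "\<not> principalideal (M i) (S i)"
  shows "\<not> cograph (with_proj (upper_ideal_graph R))"
proof -
  interpret Si: cring "S i"
    using cring_factor ij by blast
  obtain a b where ab: "a \<in> M i" "b \<in> M i"
    and no_div: "\<And>z. z \<in> M i \<Longrightarrow> \<not> (z divides\<^bsub>S i\<^esub> a \<and> z divides\<^bsub>S i\<^esub> b)"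
    using Si.ex_no_common_divisor_of_not_principal[OF finite_factor[OF ij(1)] ideal_factor[OF ij(1)] np]
    by blast
  define c where "c x y l = (if l = i then x else if l = j \<and> y then \<zero>\<^bsub>S l\<^esub> else \<one>\<^bsub>S l\<^esub>)" for x y l
  have carr: "a \<in> carrier (S i)" "b \<in> carrier (S i)"
    using ab max_closed ij by auto
  have "c x y l \<in> carrier (S l)" if "l \<in> I" "x \<in> carrier (S i)" for x y l
    using ring.ring_simprules(2,6)[OF ring_factor[OF that(1)]] that(2) by (auto simp: c_def)
  then have "\<exists>v. \<forall>x y. x \<in> carrier (S i) \<longrightarrow> v x y \<in> carrier R \<and> (\<forall>l\<in>I. p l (v x y) = c x y l)"
    using proj_surj[of "c _ _"] by metis
  then obtain v where v: "\<And>x y. x \<in> carrier (S i) \<Longrightarrow> v x y \<in> carrier R"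
    "\<And>x y l. x \<in> carrier (S i) \<Longrightarrow> l \<in> I \<Longrightarrow> p l (v x y) = c x y l"
    by blast
  have v_nonunit: "v x y \<in> nonunits R" if "x \<in> M i" for x y
    using that v[OF max_closed[OF ij(1) that]] ij by (auto simp: nonunits_iff c_def intro!: bexI[of _ i])
  have v_div: "v x y divides v x' y'"
    if "x \<in> carrier (S i)" "x' \<in> carrier (S i)" "x divides\<^bsub>S i\<^esub> x'" "y \<longrightarrow> y'" for x x' y y'
    using that ring_factor v
    by (auto simp: divides_iff c_def ring.ring_simprules intro!: ring.divides_zero ring.one_divides)
  have "\<zero>\<^bsub>S j\<^esub> \<noteq> \<one>\<^bsub>S j\<^esub>"
    using zero_in_max one_notin_max ij by metis
  then have v_neq: "v x False \<noteq> v x True" if "x \<in> carrier (S i)" for x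
    using v(2)[OF that, of j] ij by (metis c_def)
  \<comment> \<open>Otherwise \<open>a = b\<close>, and \<open>a\<close> would be a common divisor
    lying in \<open>M i\<close>.\<close>
  have "v a True \<noteq> v b True"
    using v(2)[of _ i] carr ij no_div[OF ab(1)] by (metis Si.divides_refl c_def)
  \<comment> \<open>The middle edge has the common divisor with one at \<open>i\<close> and zero at
    \<open>j\<close>, a non-unit because of the factor \<open>j\<close>.\<close>
  moreover have "v \<one>\<^bsub>S i\<^esub> True \<in> nonunits R"
    using v[of "\<one>\<^bsub>S i\<^esub>"] ij zero_in_max unfolding nonunits_iff by (auto simp: c_def intro!: bexI[of _ j])
  moreover have "v \<one>\<^bsub>S i\<^esub> True divides v x True" if "x \<in> carrier (S i)" for x
    using that Si.one_divides by (intro v_div) auto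
  ultimately have "(v a True, v b True) \<in> parcs (upper_ideal_graph R)"
    using ab carr v_nonunit unfolding parcs_upper_ideal_graph_iff by blast
  moreover have "(v a False, v a True) \<in> parcs (upper_ideal_graph R)"
    "(v b True, v b False) \<in> parcs (upper_ideal_graph R)"
    using ab carr v_neq by (auto intro!: adjacent_if_divides(1)[of "v a False"]
        adjacent_if_divides(2)[of "v b False"] v_nonunit v v_div)
  \<comment> \<open>This covers all three non-edges. At \<open>i\<close> the choice of
    \<open>a\<close> and \<open>b\<close> excludes a common divisor in \<open>M i\<close>; at any
    other index one of the two components is one, as the flags are not both set.\<close>
  moreover have "(v a y, v b y') \<notin> parcs (upper_ideal_graph R)" if "\<not> (y \<and> y')" for y y'
  proof (rule not_adjacent_if_no_common_max)
    fix l z assume l: "l \<in> I" and z: "z \<in> carrier R" "z divides v a y" "z divides v b y'"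
    show "p l z \<notin> M l"
    proof (cases "l = i")
      case True
      have "p i z divides\<^bsub>S i\<^esub> a" "p i z divides\<^bsub>S i\<^esub> b"
        using z carr v ij by (auto simp: divides_iff c_def)
      with no_div True show ?thesis
        by blast
    next
      case False
      then have "p l (v a y) \<notin> M l \<or> p l (v b y') \<notin> M l"
        using that l carr one_notin_max by (auto simp: v c_def)
      then show ?thesis
        using max_divisor l z v carr by blast
    qed
  qed
  ultimately show ?thesis
    unfolding cograph_with_proj_iff[OF graph] by blast
qed

section \<open>Principal maximal ideals\<close>

text \<open>If \<open>m\<close> generates \<open>M i\<close>, the element with \<open>m\<close> at
  \<open>i\<close> and one elsewhere is a non-unit dividing every element whose component at
  \<open>i\<close> lies in \<open>M i\<close>. Hence these elements form a clique.\<close>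

lemma adjacent_iff_if_principal:
  assumes principal: "\<And>i. i \<in> I \<Longrightarrow> principalideal (M i) (S i)"
  shows "(x, y) \<in> parcs (upper_ideal_graph R) \<longleftrightarrow>
    x \<in> carrier R \<and> y \<in> carrier R \<and> x \<noteq> y \<and> (\<exists>i\<in>I. p i x \<in> M i \<and> p i y \<in> M i)"
    (is "?L \<longleftrightarrow> ?R")
proof
  assume ?L
  then obtain z i where "z \<in> carrier R" "i \<in> I" "p i z \<in> M i" "z divides x" "z divides y"
    and xy: "x \<in> carrier R" "y \<in> carrier R" "x \<noteq> y"
    by (auto simp: parcs_upper_ideal_graph_iff nonunits_iff)
  then have "p i x \<in> M i" "p i y \<in> M i"
    using max_divisor by blast+
  with \<open>i \<in> I\<close> xy show ?R
    by blast
next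
  assume ?R
  then obtain i where i: "i \<in> I" "p i x \<in> M i" "p i y \<in> M i"
    and xy: "x \<in> carrier R" "y \<in> carrier R" "x \<noteq> y"
    by blast
  interpret Si: cring "S i"
    using cring_factor i by blast
  obtain m where m: "m \<in> carrier (S i)" "M i = Idl\<^bsub>S i\<^esub> {m}"
    using principal[OF i(1)] principalideal.generate by blast
  have "(if l = i then m else \<one>\<^bsub>S l\<^esub>) \<in> carrier (S l)" if "l \<in> I" for l
    using m ring.ring_simprules(6)[OF ring_factor[OF that]] by auto
  then obtain z where z: "z \<in> carrier R" "\<And>l. l \<in> I \<Longrightarrow> p l z = (if l = i then m else \<one>\<^bsub>S l\<^esub>)"
    using proj_surj[of "\<lambda>l. if l = i then m else \<one>\<^bsub>S l\<^esub>"] by blast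
  have "m \<in> M i"
    using m Si.genideal_self' by simp
  then have "z \<in> nonunits R"
    using z i by (auto simp: nonunits_iff)
  moreover have "z divides w" if "w \<in> carrier R" "p i w \<in> M i" for w
  proof -
    have "m divides\<^bsub>S i\<^esub> p i w"
      using that m i(1) proj_closed Si.genideal_subset_iff_divides[of "p i w" m]
        Si.genideal_minimal[OF ideal_factor[OF i(1)]] by auto
    then show ?thesis
      using that z proj_closed ring_factor by (auto simp: divides_iff intro!: ring.one_divides)
  qed
  moreover have "x \<in> nonunits R" "y \<in> nonunits R"
    using i xy by (auto simp: nonunits_iff)
  ultimately show ?L
    using i xy unfolding parcs_upper_ideal_graph_iff by blast
qed

text \<open>All edges lie in two cliques, one for each index. Two of the three edges of a path on
  four vertices then lie in the same clique, which joins two vertices that an induced path keeps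
  apart.\<close>

lemma cograph_if_principal:
  assumes I: "I = {i, j}" and principal: "\<And>k. k \<in> I \<Longrightarrow> principalideal (M k) (S k)"
  shows "cograph (with_proj (upper_ideal_graph R))"
proof -
  let ?A = "\<lambda>x y. (x, y) \<in> parcs (upper_ideal_graph R)"
  have adj: "?A x y \<longleftrightarrow> x \<in> carrier R \<and> y \<in> carrier R \<and> x \<noteq> y \<and>
      (p i x \<in> M i \<and> p i y \<in> M i \<or> p j x \<in> M j \<and> p j y \<in> M j)" for x y
    using adjacent_iff_if_principal[OF principal] I by simp
  have "\<not> (?A a b \<and> ?A b c \<and> ?A c d \<and> \<not> ?A a c \<and> \<not> ?A a d \<and> \<not> ?A b d)" for a b c d
    unfolding adj by auto
  then show ?thesis
    unfolding cograph_with_proj_iff[OF graph] by blast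
qed

end

section \<open>Coordinates in the product of a list of rings\<close>

text \<open>Consing is a ring homomorphism from the binary product of \<open>R\<close> and
  \<open>RDirProd_list Rs\<close>, whose operations are componentwise.\<close>

lemma RDirProd_list_Cons_simps:
  assumes "a \<in> carrier R" "b \<in> carrier R" "as \<in> carrier (RDirProd_list Rs)" "bs \<in> carrier (RDirProd_list Rs)"
  shows "(a # as) \<otimes>\<^bsub>RDirProd_list (R # Rs)\<^esub> (b # bs) = (a \<otimes>\<^bsub>R\<^esub> b) # (as \<otimes>\<^bsub>RDirProd_list Rs\<^esub> bs)"
    and "(a # as) \<oplus>\<^bsub>RDirProd_list (R # Rs)\<^esub> (b # bs) = (a \<oplus>\<^bsub>R\<^esub> b) # (as \<oplus>\<^bsub>RDirProd_list Rs\<^esub> bs)"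
  using assms ring_hom_mult[OF RDirProd_list_hom1, of "(a, as)" R Rs "(b, bs)"]
    ring_hom_add[OF RDirProd_list_hom1, of "(a, as)" R Rs "(b, bs)"]
  by (auto simp: RDirProd_def DirProd_def monoid.defs)

lemma nth_ring_hom_RDirProd_list:
  assumes "i < length Rs"
  shows "(\<lambda>xs. xs ! i) \<in> ring_hom (RDirProd_list Rs) (Rs ! i)"
  using assms
proof (induction Rs arbitrary: i)
  case (Cons R Rs)
  show ?case
  proof (cases i)
    case 0
    show ?thesis
      by (rule ring_hom_memI) (auto simp: 0 RDirProd_list_carrier RDirProd_list_Cons_simps RDirProd_list_one)
  next
    case (Suc k)
    have hom: "(\<lambda>xs. xs ! k) \<in> ring_hom (RDirProd_list Rs) (Rs ! k)"
      using Cons Suc by simp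
    show ?thesis
      using ring_hom_closed[OF hom] ring_hom_mult[OF hom] ring_hom_add[OF hom] ring_hom_one[OF hom]
      by (intro ring_hom_memI)
        (auto simp: Suc RDirProd_list_carrier RDirProd_list_Cons_simps RDirProd_list_one)
  qed
qed simp

theorem theorem3p3:
  fixes R :: "('a, 'm) ring_scheme"
    and Rs :: "('b, 'k) ring_scheme list"
    and M :: "nat \<Rightarrow> 'b set"
    and n :: nat
  assumes "cring R"
    and "finite (carrier R)"
    and "\<not> local_ring R"
    and "n \<ge> 2"
    and "length Rs = n"
    and "\<And>i. i < n \<Longrightarrow> local_ring (Rs ! i)"
    and "\<And>i. i < n \<Longrightarrow> maximalideal (M i) (Rs ! i)"
    and "R \<simeq> RDirProd_list Rs"
  shows "cograph (with_proj (upper_ideal_graph R)) \<longleftrightarrow>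
    n = 2 \<and> principalideal (M 0) (Rs ! 0) \<and> principalideal (M 1) (Rs ! 1)"
proof -
  obtain h where h: "h \<in> ring_iso R (RDirProd_list Rs)"
    using assms(8) by (auto simp: is_ring_iso_def)
  then have hom: "h \<in> ring_hom R (RDirProd_list Rs)"
    and bij: "bij_betw h (carrier R) (carrier (RDirProd_list Rs))"
    by (auto simp: ring_iso_def)
  \<comment> \<open>The projections read off the entries of the list \<open>h x\<close>, where
    \<open>h\<close> is the given isomorphism.\<close>
  interpret local_ring_product R "{..<n}" "\<lambda>i. Rs ! i" M "\<lambda>i x. h x ! i"
  proof (intro local_ring_product.intro local_ring_product_axioms.intro)
    show "(\<lambda>x. h x ! i) \<in> ring_hom R (Rs ! i)" if "i \<in> {..<n}" for i
      using ring_hom_trans[OF hom nth_ring_hom_RDirProd_list[of i Rs]] that assms(5)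
      by (simp add: comp_def)
  next
    fix x y assume xy: "x \<in> carrier R" "y \<in> carrier R" "\<And>i. i \<in> {..<n} \<Longrightarrow> h x ! i = h y ! i"
    have "h x = h y"
      using xy ring_hom_closed[OF hom] RDirProd_list_carrier_mem(1) assms(5)
      by (metis lessThan_iff nth_equalityI)
    then show "x = y"
      using bij xy by (auto simp: bij_betw_def inj_on_def)
  next
    fix c :: "nat \<Rightarrow> 'b"
    assume "\<And>i. i \<in> {..<n} \<Longrightarrow> c i \<in> carrier (Rs ! i)"
    then have "map c [0..<n] \<in> carrier (RDirProd_list Rs)"
      using assms(5) by (intro RDirProd_list_carrier_memI) auto
    then obtain x where "x \<in> carrier R" "h x = map c [0..<n]"
      using bij unfolding bij_betw_def by (metis imageE)
    then show "\<exists>x\<in>carrier R. \<forall>i\<in>{..<n}. h x ! i = c i"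
      by (intro bexI[of _ x]) auto
  qed (use assms in auto)
  show ?thesis
  proof
    assume cog: "cograph (with_proj (upper_ideal_graph R))"
    then have "\<not> 2 < n"
      using not_cograph_if_three_factors[of 0 1 2] by auto
    then have "n = 2"
      using assms(4) by simp
    \<comment> \<open>The two factors are used in both orders, once for each maximal ideal.\<close>
    then show "n = 2 \<and> principalideal (M 0) (Rs ! 0) \<and> principalideal (M 1) (Rs ! 1)"
      using cog not_cograph_if_not_principal[of 0 1] not_cograph_if_not_principal[of 1 0] by auto
  next
    assume *: "n = 2 \<and> principalideal (M 0) (Rs ! 0) \<and> principalideal (M 1) (Rs ! 1)"
    then have "{..<n} = {0, 1}"
      by auto
    then show "cograph (with_proj (upper_ideal_graph R))"
      using * by (intro cograph_if_principal[of 0 1]) auto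
  qed
qed

end
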